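(* Let $0=t_0<t_1<\dots<t_N=1$ and let $\widetilde V(t_n,\cdot):\mathbb{R}^d\to\mathbb{R}^d$, $n=0,\dots,N-1$, be a (differentiable) learned velocity field satisfying $$\|\nabla\widetilde V(t_n,\cdot)\|_\infty\le(K_1+K_2+K_8)t_n,\qquad n=0,\dots,N-1,$$ for some positive constant $K_8$, with $K_1,K_2\geq 0$ as in the context. Let $\overset{\leftarrow}{Y}_1(x)$ denote the time-one value of the learned flow started at $\overset{\leftarrow}{Y}_0=x$ and defined by $\frac{d}{dt}\overset{\leftarrow}{Y}_t=\widetilde V(t_n,\overset{\leftarrow}{Y}_{t_n})$ for $t\in[t_n,t_{n+1}]$, $n=0,\dots,N-1$. Then $$\mathrm{Lip}(\overset{\leftarrow}{Y}_1)\le\sup_x\|\nabla\overset{\leftarrow}{Y}_1(x)\|_{op}\le\exp\Big(\frac{K_1+K_2+K_8}{2}\Big).$$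
   Context: $\|\cdot\|=\|\cdot\|_{op}$ is the operator norm of matrices, $|\cdot|$ the Euclidean norm, $|f|_\infty=\sup_x|f(x)|$, $\|F\|_\infty=\sup_x\|F(x)\|$. The constants $K_1,K_2$ are attached to a target density $\bar p_0(x)=\exp(-(A^{-1}x,x)/2)\exp(h(x))$, $\bar p_0\in C^2(\mathbb{R}^d)$, and a symmetric positive-definite matrix $C$, where $A$ is symmetric positive definite and simultaneously diagonalizable with $C$, with $|\sqrt C\nabla h|_\infty<\infty$ and $\|C\nabla^2h\|_\infty<\infty$: with $\bar A_t=t^2A+(1-t^2)C$ and $K=\sup_{0\le t\le1}\|A\bar A_t^{-1}\|$, one sets $K_1=K^2(\|C\nabla^2h\|_\infty+|\sqrt C\nabla h|_\infty^2)$ and $K_2=\sup_{0\le t\le1}\|(A-C)\bar A_t^{-1}\|$. *)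

theory Defs
  imports "HOL-Analysis.Analysis"
begin

definition sym_posdef :: "real^'n^'n \<Rightarrow> bool" where
  "sym_posdef M \<longleftrightarrow> transpose M = M \<and> (\<forall>v. v \<noteq> 0 \<longrightarrow> (M *v v) \<bullet> v > 0)"

definition diagonal_matrix :: "real^'n^'n \<Rightarrow> bool" where
  "diagonal_matrix D \<longleftrightarrow> (\<forall>i j. i \<noteq> j \<longrightarrow> D $ i $ j = 0)"

definition simultaneously_diagonalizable :: "real^'n^'n \<Rightarrow> real^'n^'n \<Rightarrow> bool" where
  "simultaneously_diagonalizable A C \<longleftrightarrow>
     (\<exists>P :: real^'n^'n. invertible P \<and> diagonal_matrix (matrix_inv P ** A ** P)
          \<and> diagonal_matrix (matrix_inv P ** C ** P))"

text \<open>The principal square root, which is unique for positive semidefinite arguments.\<close>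

definition psd_sqrt :: "real^'n^'n \<Rightarrow> real^'n^'n" where
  "psd_sqrt C = (THE S. transpose S = S \<and> (\<forall>v. (S *v v) \<bullet> v \<ge> 0) \<and> S ** S = C)"

text \<open>The type-class norm on \<open>real^'n^'n\<close> is the Frobenius norm, so the operator norm has to be
  taken of the induced linear map.\<close>

definition op_norm :: "real^'n^'m \<Rightarrow> real" where
  "op_norm M = onorm ((*v) M)"

text \<open>The suprema over the whole space are extended reals, so that unbounded functions have
  supremum \<open>\<infinity>\<close> rather than an unspecified real value.\<close>

definition sup_norm :: "(real^'n \<Rightarrow> real^'m) \<Rightarrow> ereal" where
  "sup_norm f = (SUP x. ereal (norm (f x)))"

definition sup_op_norm :: "(real^'n \<Rightarrow> real^'k^'m) \<Rightarrow> ereal" where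
  "sup_op_norm F = (SUP x. ereal (op_norm (F x)))"

definition grad :: "(real^'n \<Rightarrow> real) \<Rightarrow> real^'n \<Rightarrow> real^'n" where
  "grad f x = (\<chi> i. frechet_derivative f (at x) (axis i 1))"

definition hessian :: "(real^'n \<Rightarrow> real) \<Rightarrow> real^'n \<Rightarrow> real^'n^'n" where
  "hessian f x = jacobian (grad f) (at x)"

definition C2 :: "(real^'n \<Rightarrow> real) \<Rightarrow> bool" where
  "C2 f \<longleftrightarrow> (\<forall>x. f differentiable (at x)) \<and> (\<forall>x. grad f differentiable (at x))
            \<and> continuous_on UNIV (hessian f)"

definition Abar :: "real^'n^'n \<Rightarrow> real^'n^'n \<Rightarrow> real \<Rightarrow> real^'n^'n" where
  "Abar A C t = t\<^sup>2 *\<^sub>R A + (1 - t\<^sup>2) *\<^sub>R C"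

definition K_const :: "real^'n^'n \<Rightarrow> real^'n^'n \<Rightarrow> real" where
  "K_const A C = (SUP t\<in>{0..1}. op_norm (A ** matrix_inv (Abar A C t)))"

text \<open>Meaningful only when both suprema over the space are finite, because \<open>real_of_ereal\<close> sends
  \<open>\<infinity>\<close> to 0.\<close>

definition K1_const :: "real^'n^'n \<Rightarrow> real^'n^'n \<Rightarrow> (real^'n \<Rightarrow> real) \<Rightarrow> real" where
  "K1_const A C h = (K_const A C)\<^sup>2 *
     (real_of_ereal (sup_op_norm (\<lambda>x. C ** hessian h x))
      + (real_of_ereal (sup_norm (\<lambda>x. psd_sqrt C *v grad h x)))\<^sup>2)"

definition K2_const :: "real^'n^'n \<Rightarrow> real^'n^'n \<Rightarrow> real" where
  "K2_const A C = (SUP t\<in>{0..1}. op_norm ((A - C) ** matrix_inv (Abar A C t)))"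

text \<open>\<open>Y t x\<close> is the value at time \<open>t\<close> of the flow started at \<open>x\<close>. The velocity is frozen on each
  closed grid interval, so at grid points the derivative is one-sided in each adjacent interval.\<close>

definition learned_flow ::
  "nat \<Rightarrow> (nat \<Rightarrow> real) \<Rightarrow> (real \<Rightarrow> real^'n \<Rightarrow> real^'n) \<Rightarrow> (real \<Rightarrow> real^'n \<Rightarrow> real^'n) \<Rightarrow> bool" where
  "learned_flow N \<tau> V Y \<longleftrightarrow>
     (\<forall>x. Y 0 x = x) \<and>
     (\<forall>x. \<forall>n<N. \<forall>t\<in>{\<tau> n..\<tau> (Suc n)}.
        ((\<lambda>s. Y s x) has_vector_derivative V (\<tau> n) (Y (\<tau> n) x)) (at t within {\<tau> n..\<tau> (Suc n)}))"

text \<open>The least Lipschitz constant, \<open>\<infinity>\<close> if there is none.\<close>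

definition Lip :: "(real^'n \<Rightarrow> real^'m) \<Rightarrow> ereal" where
  "Lip f = Inf {ereal L | L. L-lipschitz_on UNIV f}"

end

theory Submission
  imports Defs
begin

text \<open>On each grid interval the velocity is frozen, so the flow is an explicit Euler scheme: one step
  multiplies the Jacobian by \<open>I + (t\<^sub>n\<^sub>+\<^sub>1 - t\<^sub>n) \<nabla>V(t\<^sub>n, \<cdot>)\<close>, whose operator norm is at most
  \<open>1 + k t\<^sub>n (t\<^sub>n\<^sub>+\<^sub>1 - t\<^sub>n) \<le> exp (k (t\<^sub>n\<^sub>+\<^sub>1\<^sup>2 - t\<^sub>n\<^sup>2) / 2)\<close>, where \<open>k = K\<^sub>1 + K\<^sub>2 + K\<^sub>8\<close>. The
  exponents telescope to \<open>k / 2\<close>. The last inequality needs \<open>k \<ge> 0\<close>; for \<open>K\<^sub>2\<close> this rests on the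
  boundedness of \<open>(A - C) Abar\<^sub>t\<^sup>-\<^sup>1\<close> in \<open>t\<close>, since an unbounded real supremum is unspecified.\<close>

lemma op_norm_nonneg: "op_norm M \<ge> 0"
  unfolding op_norm_def by (intro onorm_pos_le matrix_vector_mul_bounded_linear)

lemma sup_op_norm_le_iff: "sup_op_norm F \<le> ereal b \<longleftrightarrow> (\<forall>x. op_norm (F x) \<le> b)"
  unfolding sup_op_norm_def by (simp add: SUP_le_iff)

lemma sup_op_norm_nonneg: "0 \<le> sup_op_norm F"
  unfolding sup_op_norm_def by (rule SUP_upper2[of undefined]) (simp_all add: op_norm_nonneg)

text \<open>The quadratic form attains a minimum on the compact unit sphere. That minimum is
  positive, and homogeneity of degree 2 carries the bound to all vectors.\<close>

lemma sym_posdef_coercive: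
  assumes "sym_posdef M"
  obtains c where "c > 0" "\<And>v. c * (norm v)\<^sup>2 \<le> (M *v v) \<bullet> v"
proof -
  let ?q = "\<lambda>v. (M *v v) \<bullet> v" and ?S = "sphere (0::real^'n) 1"
  have "continuous_on ?S ?q"
    by (intro continuous_intros)
  \<comment> \<open>Attaining a minimum needs a nonempty sphere; any coordinate vector
    serves.\<close>
  moreover have "axis undefined 1 \<in> ?S"
    by simp
  ultimately obtain u where u: "u \<in> ?S" "\<And>v. v \<in> ?S \<Longrightarrow> ?q u \<le> ?q v"
    using continuous_attains_inf[of ?S ?q] compact_sphere by blast
  show thesis
  proof
    have "u \<noteq> 0"
      using u(1) by auto
    then show "?q u > 0"
      using assms by (simp add: sym_posdef_def)
    show "?q u * (norm v)\<^sup>2 \<le> ?q v" for v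
    proof (cases "v = 0")
      case False
      define w where "w = (1 / norm v) *\<^sub>R v"
      have v: "v = norm v *\<^sub>R w" and "w \<in> ?S"
        using False by (auto simp: w_def)
      have "?q v = (norm v)\<^sup>2 * ?q w"
        by (subst (1 2) v) (simp add: matrix_vector_mult_scaleR power2_eq_square)
      then show ?thesis
        using u(2)[OF \<open>w \<in> ?S\<close>] by (simp add: mult.commute mult_right_mono)
    qed simp
  qed
qed

text \<open>A convex combination of \<open>A\<close> and \<open>C\<close> inherits the smaller of
  their coercivity constants, so one \<open>c\<close> serves all times. This uniformity is what
  bounds the supremum in \<open>K2_const\<close>.\<close>

lemma Abar_coercive:
  fixes A C :: "real^'n^'n"
  assumes "sym_posdef A" "sym_posdef C"
  obtains c where "c > 0" "\<And>t v. t \<in> {0..1} \<Longrightarrow> c * (norm v)\<^sup>2 \<le> (Abar A C t *v v) \<bullet> v"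
proof -
  obtain a where a: "a > 0" "\<And>v. a * (norm v)\<^sup>2 \<le> (A *v v) \<bullet> v"
    by (rule sym_posdef_coercive[OF assms(1)]) blast
  obtain b where b: "b > 0" "\<And>v. b * (norm v)\<^sup>2 \<le> (C *v v) \<bullet> v"
    by (rule sym_posdef_coercive[OF assms(2)]) blast
  show thesis
  proof
    show "min a b > 0"
      using a b by simp
    fix t :: real and v :: "real^'n"
    assume t: "t \<in> {0..1}"
    then have t2: "0 \<le> t\<^sup>2" "0 \<le> 1 - t\<^sup>2"
      by (auto simp: power_le_one)
    have "min a b * (norm v)\<^sup>2 \<le> (A *v v) \<bullet> v" "min a b * (norm v)\<^sup>2 \<le> (C *v v) \<bullet> v"
      using a(2)[of v] b(2)[of v] by (meson min.cobounded1 min.cobounded2 mult_right_mono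
          order_trans zero_le_power2)+
    then have "t\<^sup>2 * (min a b * (norm v)\<^sup>2) + (1 - t\<^sup>2) * (min a b * (norm v)\<^sup>2)
        \<le> t\<^sup>2 * ((A *v v) \<bullet> v) + (1 - t\<^sup>2) * ((C *v v) \<bullet> v)"
      using t2 by (intro add_mono mult_left_mono)
    also have "\<dots> = (Abar A C t *v v) \<bullet> v"
      by (simp add: Abar_def matrix_vector_mult_add_rdistrib inner_add_left
          flip: scaleR_matrix_vector_assoc)
    finally show "min a b * (norm v)\<^sup>2 \<le> (Abar A C t *v v) \<bullet> v"
      by (simp add: algebra_simps)
  qed
qed

text \<open>By Cauchy-Schwarz, coercivity gives \<open>c * norm v \<le> norm (M *v v)\<close>, so
  \<open>M\<close> is invertible and its inverse has operator norm at most
  \<open>1 / c\<close>.\<close>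

lemma op_norm_mult_matrix_inv_le:
  fixes B M :: "real^'n^'n"
  assumes "c > 0" and coercive: "\<And>v. c * (norm v)\<^sup>2 \<le> (M *v v) \<bullet> v"
  shows "op_norm (B ** matrix_inv M) \<le> op_norm B / c"
proof -
  have lower: "c * norm v \<le> norm (M *v v)" for v
  proof (cases "v = 0")
    case False
    have "(c * norm v) * norm v \<le> norm (M *v v) * norm v"
      using coercive[of v] norm_cauchy_schwarz[of "M *v v" v] by (simp add: power2_eq_square)
    then show ?thesis
      using False by simp
  qed simp
  have "inj ((*v) M)"
  proof (rule injI)
    fix x y assume "M *v x = M *v y"
    then have "c * norm (x - y) \<le> 0"
      using lower[of "x - y"] by (simp add: matrix_vector_mult_diff_distrib)
    then show "x = y"
      using \<open>c > 0\<close> by (simp add: mult_le_0_iff)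
  qed
  then have "invertible M"
    using invertible_left_inverse matrix_left_invertible_injective by blast
  \<comment> \<open>\<open>matrix_inv\<close> is defined by choice, so its defining property follows
    once some inverse is known to exist.\<close>
  then have inv: "M ** matrix_inv M = mat 1"
    unfolding invertible_def matrix_inv_def by (rule someI2_ex) blast
  show ?thesis
    unfolding op_norm_def
  proof (rule onorm_le)
    fix w
    have "c * norm (matrix_inv M *v w) \<le> norm w"
      using lower[of "matrix_inv M *v w"] by (simp add: matrix_vector_mul_assoc inv)
    then have "norm (matrix_inv M *v w) \<le> norm w / c"
      using \<open>c > 0\<close> by (simp add: field_simps)
    then have "onorm ((*v) B) * norm (matrix_inv M *v w) \<le> onorm ((*v) B) * (norm w / c)"
      using op_norm_nonneg[of B] by (intro mult_left_mono) (simp_all add: op_norm_def)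
    then have "norm (B *v (matrix_inv M *v w)) \<le> onorm ((*v) B) * (norm w / c)"
      using onorm[OF matrix_vector_mul_bounded_linear, of B "matrix_inv M *v w"]
      by (rule order_trans[rotated])
    then show "norm ((B ** matrix_inv M) *v w) \<le> onorm ((*v) B) / c * norm w"
      by (simp add: matrix_vector_mul_assoc)
  qed
qed

text \<open>\<open>K_const\<close> enters only through its square, and \<open>real_of_ereal\<close>
  sends nonnegative suprema, even infinite ones, to nonnegative reals.\<close>

lemma K1_const_nonneg: "K1_const A C h \<ge> 0"
  unfolding K1_const_def by (simp add: real_of_ereal_pos sup_op_norm_nonneg)

lemma K2_const_nonneg:
  assumes "sym_posdef A" "sym_posdef C"
  shows "K2_const A C \<ge> 0"
proof -
  obtain c where c: "c > 0" "\<And>t v. t \<in> {0..1} \<Longrightarrow> c * (norm v)\<^sup>2 \<le> (Abar A C t *v v) \<bullet> v"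
    by (rule Abar_coercive[OF assms]) blast
  then have "bdd_above ((\<lambda>t. op_norm ((A - C) ** matrix_inv (Abar A C t))) ` {0..1})"
    by (intro bdd_aboveI2[where M = "op_norm (A - C) / c"] op_norm_mult_matrix_inv_le)
  \<comment> \<open>The supremum dominates the operator norm at time 0.\<close>
  then show ?thesis
    unfolding K2_const_def
    by (intro cSUP_upper2[of _ _ 0] op_norm_nonneg) auto
qed

text \<open>The mean value inequality on the convex domain \<open>UNIV\<close> makes the supremum, a
  real number by finiteness, one of the Lipschitz constants over which \<open>Lip\<close> takes the
  infimum.\<close>

lemma Lip_le_sup_op_norm_jacobian:
  fixes f :: "real^'n \<Rightarrow> real^'m"
  assumes diff: "\<And>x. f differentiable (at x)"
    and finite: "sup_op_norm (\<lambda>x. jacobian f (at x)) < \<infinity>"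
  shows "Lip f \<le> sup_op_norm (\<lambda>x. jacobian f (at x))"
proof -
  obtain L where L: "sup_op_norm (\<lambda>x. jacobian f (at x)) = ereal L"
    using finite sup_op_norm_nonneg[of "\<lambda>x. jacobian f (at x)"]
    by (cases "sup_op_norm (\<lambda>x. jacobian f (at x))") auto
  then have bound: "op_norm (jacobian f (at x)) \<le> L" for x
    using sup_op_norm_le_iff by (metis order_refl)
  have "L-lipschitz_on UNIV f"
  proof (rule lipschitz_onI)
    show "0 \<le> L"
      using bound[of undefined] op_norm_nonneg order_trans by blast
    show "dist (f x) (f y) \<le> L * dist x y" for x y
      unfolding dist_norm
    proof (rule differentiable_bound[of UNIV])
      show "(f has_derivative (*v) (jacobian f (at z))) (at z within UNIV)" for z
        using diff[of z] by (simp add: jacobian_works)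
    qed (use bound in \<open>auto simp: op_norm_def\<close>)
  qed
  then show ?thesis
    unfolding Lip_def L by (intro Inf_lower) blast
qed

lemma learned_flow_step:
  assumes "learned_flow N \<tau> V Y" "n < N" "\<tau> n < \<tau> (Suc n)"
  shows "Y (\<tau> (Suc n)) x = Y (\<tau> n) x + (\<tau> (Suc n) - \<tau> n) *\<^sub>R V (\<tau> n) (Y (\<tau> n) x)"
proof -
  let ?I = "{\<tau> n..\<tau> (Suc n)}" and ?v = "V (\<tau> n) (Y (\<tau> n) x)"
  have "((\<lambda>s. Y s x - s *\<^sub>R ?v) has_vector_derivative 0) (at t within ?I)" if "t \<in> ?I" for t
  proof -
    have "((\<lambda>s. Y s x) has_vector_derivative ?v) (at t within ?I)"
      using assms(1,2) that unfolding learned_flow_def by blast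
    then show ?thesis
      by (auto intro!: derivative_eq_intros)
  qed
  then obtain c where "\<And>t. t \<in> ?I \<Longrightarrow> Y t x - t *\<^sub>R ?v = c"
    using has_vector_derivative_zero_constant[OF convex_real_interval(5)] by blast
  from this[of "\<tau> n"] this[of "\<tau> (Suc n)"]
  have "Y (\<tau> n) x - \<tau> n *\<^sub>R ?v = Y (\<tau> (Suc n)) x - \<tau> (Suc n) *\<^sub>R ?v"
    using assms(3) by simp
  then show ?thesis
    by (simp add: algebra_simps)
qed

text \<open>Here \<open>D\<close> stands for the derivative of the flow so far, \<open>E\<close> for
  that of the velocity at the point reached, and \<open>\<delta>\<close> for the step
  length.\<close>

lemma onorm_euler_step_le:
  fixes D E :: "'a::euclidean_space \<Rightarrow> 'a"
  assumes "bounded_linear D" "bounded_linear E" "\<delta> \<ge> 0"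
  shows "onorm (\<lambda>v. D v + \<delta> *\<^sub>R E (D v)) \<le> (1 + \<delta> * onorm E) * onorm D"
proof -
  have ED: "bounded_linear (\<lambda>v. E (D v))"
    using bounded_linear_compose[OF assms(2,1)] .
  have "onorm (\<lambda>v. D v + \<delta> *\<^sub>R E (D v)) \<le> onorm D + onorm (\<lambda>v. \<delta> *\<^sub>R E (D v))"
    by (intro onorm_triangle assms(1) bounded_linear_const_scaleR ED)
  also have "onorm (\<lambda>v. \<delta> *\<^sub>R E (D v)) = \<delta> * onorm (\<lambda>v. E (D v))"
    using onorm_scaleR[OF ED, of \<delta>] \<open>\<delta> \<ge> 0\<close> by simp
  also have "\<dots> \<le> \<delta> * (onorm E * onorm D)"
    using onorm_compose[OF assms(2,1)] \<open>\<delta> \<ge> 0\<close> by (simp add: comp_def mult_left_mono)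
  finally show ?thesis
    by (simp add: algebra_simps)
qed

text \<open>The exponent is the integral of \<open>k * r\<close> over \<open>r\<close> from
  \<open>s\<close> to \<open>t\<close>. It exceeds the left-endpoint value
  \<open>(t - s) * (k * s)\<close> by \<open>k * (t - s)\<^sup>2 / 2\<close>, and
  \<open>1 + x \<le> exp x\<close> does the rest.\<close>

lemma euler_factor_le_exp:
  fixes k s t :: real
  assumes "k \<ge> 0"
  shows "1 + (t - s) * (k * s) \<le> exp (k * (t\<^sup>2 - s\<^sup>2) / 2)"
proof -
  have "0 \<le> k * (t - s)\<^sup>2"
    using assms by simp
  then have "(t - s) * (k * s) \<le> k * (t\<^sup>2 - s\<^sup>2) / 2"
    by (simp add: power2_eq_square algebra_simps)
  then show ?thesis
    using exp_ge_add_one_self[of "k * (t\<^sup>2 - s\<^sup>2) / 2"] by linarith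
qed

text \<open>Induction over the grid points with the chain rule. Differentiability and the bound are
  carried together, and the exponent at each grid point is the telescoped sum up to there.\<close>

lemma learned_flow_derivative_bound:
  assumes flow: "learned_flow N \<tau> V Y"
    and "\<tau> 0 = 0" and step: "\<And>n. n < N \<Longrightarrow> \<tau> n < \<tau> (Suc n)"
    and diff: "\<And>n x. n < N \<Longrightarrow> V (\<tau> n) differentiable (at x)"
    and "k \<ge> 0"
    and bound: "\<And>n x. n < N \<Longrightarrow> op_norm (jacobian (V (\<tau> n)) (at x)) \<le> k * \<tau> n"
    and "n \<le> N"
  shows "\<exists>D. (Y (\<tau> n) has_derivative D) (at x) \<and> onorm D \<le> exp (k * (\<tau> n)\<^sup>2 / 2)"
  using \<open>n \<le> N\<close>
proof (induction n)
  case 0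
  \<comment> \<open>The initial derivative is the identity, of norm
    \<open>1 = exp 0\<close>.\<close>
  have "Y (\<tau> 0) = (\<lambda>x. x)"
    using flow \<open>\<tau> 0 = 0\<close> by (auto simp: learned_flow_def)
  then show ?case
    by (intro exI[of _ "\<lambda>v. v"]) (simp add: \<open>\<tau> 0 = 0\<close> onorm_id)
next
  case (Suc n)
  then have "n < N"
    by simp
  obtain D where D: "(Y (\<tau> n) has_derivative D) (at x)" "onorm D \<le> exp (k * (\<tau> n)\<^sup>2 / 2)"
    using Suc by auto
  define E where "E = (*v) (jacobian (V (\<tau> n)) (at (Y (\<tau> n) x)))"
  define \<delta> where "\<delta> = \<tau> (Suc n) - \<tau> n"
  have E: "(V (\<tau> n) has_derivative E) (at (Y (\<tau> n) x))"
    using diff[OF \<open>n < N\<close>] by (simp add: E_def jacobian_works)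
  have "onorm E \<le> k * \<tau> n"
    using bound[OF \<open>n < N\<close>] by (simp add: E_def op_norm_def)
  have "\<delta> \<ge> 0"
    using step[OF \<open>n < N\<close>] by (simp add: \<delta>_def)
  note lin = has_derivative_bounded_linear[OF D(1)] has_derivative_bounded_linear[OF E]
  have "Y (\<tau> (Suc n)) = (\<lambda>x. Y (\<tau> n) x + \<delta> *\<^sub>R V (\<tau> n) (Y (\<tau> n) x))"
    using learned_flow_step[OF flow \<open>n < N\<close> step[OF \<open>n < N\<close>]] by (auto simp: \<delta>_def)
  then have "(Y (\<tau> (Suc n)) has_derivative (\<lambda>v. D v + \<delta> *\<^sub>R E (D v))) (at x)"
    using has_derivative_compose[OF D(1) E] D(1)
    by (auto intro!: has_derivative_add has_derivative_scaleR_right)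
  moreover have "onorm (\<lambda>v. D v + \<delta> *\<^sub>R E (D v)) \<le> exp (k * (\<tau> (Suc n))\<^sup>2 / 2)"
  proof -
    have "onorm (\<lambda>v. D v + \<delta> *\<^sub>R E (D v)) \<le> (1 + \<delta> * onorm E) * onorm D"
      using onorm_euler_step_le[OF lin \<open>\<delta> \<ge> 0\<close>] .
    also have "1 + \<delta> * onorm E \<le> 1 + \<delta> * (k * \<tau> n)"
      using \<open>onorm E \<le> k * \<tau> n\<close> \<open>\<delta> \<ge> 0\<close> by (simp add: mult_left_mono)
    also have "\<dots> \<le> exp (k * ((\<tau> (Suc n))\<^sup>2 - (\<tau> n)\<^sup>2) / 2)"
      unfolding \<delta>_def by (rule euler_factor_le_exp[OF \<open>k \<ge> 0\<close>])
    also note D(2)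
    \<comment> \<open>The terms in \<open>(\<tau> n)\<^sup>2\<close> cancel: this is the
      telescoping.\<close>
    also have "exp (k * ((\<tau> (Suc n))\<^sup>2 - (\<tau> n)\<^sup>2) / 2) * exp (k * (\<tau> n)\<^sup>2 / 2)
        = exp (k * (\<tau> (Suc n))\<^sup>2 / 2)"
      by (simp add: algebra_simps diff_divide_distrib flip: exp_add)
    \<comment> \<open>Enlarging the left factor of the product requires
      \<open>onorm D \<ge> 0\<close>.\<close>
    finally show ?thesis
      using onorm_pos_le[OF lin(1)] by (simp add: mult_right_mono)
  qed
  ultimately show ?case
    by blast
qed

theorem corollary3p14:
  fixes A C :: "real^'n^'n"
    and p0 h :: "real^'n \<Rightarrow> real"
    and N :: nat and \<tau> :: "nat \<Rightarrow> real"
    and V Y :: "real \<Rightarrow> real^'n \<Rightarrow> real^'n"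
    and K8 :: real
  assumes "sym_posdef A" and "sym_posdef C" and "simultaneously_diagonalizable A C"
    and "has_bochner_integral lborel p0 1"
    and "\<And>x. p0 x = exp (- ((matrix_inv A *v x) \<bullet> x) / 2) * exp (h x)"
    and "C2 p0"
    and "sup_norm (\<lambda>x. psd_sqrt C *v grad h x) < \<infinity>"
    and "sup_op_norm (\<lambda>x. C ** hessian h x) < \<infinity>"
    and "\<tau> 0 = 0" and "\<And>n. n < N \<Longrightarrow> \<tau> n < \<tau> (Suc n)" and "\<tau> N = 1"
    and "\<And>n x. n < N \<Longrightarrow> V (\<tau> n) differentiable (at x)"
    and "K8 > 0"
    and "\<And>n. n < N \<Longrightarrow> sup_op_norm (\<lambda>x. jacobian (V (\<tau> n)) (at x))
           \<le> ereal ((K1_const A C h + K2_const A C + K8) * \<tau> n)"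
    and "learned_flow N \<tau> V Y"
  shows "(\<forall>x. Y 1 differentiable (at x))
    \<and> Lip (Y 1) \<le> sup_op_norm (\<lambda>x. jacobian (Y 1) (at x))
    \<and> sup_op_norm (\<lambda>x. jacobian (Y 1) (at x))
        \<le> ereal (exp ((K1_const A C h + K2_const A C + K8) / 2))"
proof -
  define k where "k = K1_const A C h + K2_const A C + K8"
  have "k \<ge> 0"
    using K1_const_nonneg[of A C h] K2_const_nonneg[OF assms(1,2)] \<open>K8 > 0\<close> by (simp add: k_def)
  have "op_norm (jacobian (V (\<tau> n)) (at x)) \<le> k * \<tau> n" if "n < N" for n x
    using assms(14)[OF that] by (simp add: k_def sup_op_norm_le_iff)
  \<comment> \<open>The last grid point is \<open>\<tau> N = 1\<close>, where the exponent becomes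
    \<open>k / 2\<close>.\<close>
  then have deriv: "\<exists>D. (Y 1 has_derivative D) (at x) \<and> onorm D \<le> exp (k / 2)" for x
    using learned_flow_derivative_bound[where n = N, OF assms(15,9,10,12) \<open>k \<ge> 0\<close>] \<open>\<tau> N = 1\<close> by simp
  then have diff: "Y 1 differentiable (at x)" for x
    unfolding differentiable_def by blast
  \<comment> \<open>Uniqueness of derivatives identifies \<open>D\<close> with the map induced by
    the Jacobian.\<close>
  have "op_norm (jacobian (Y 1) (at x)) \<le> exp (k / 2)" for x
    using deriv[of x] diff[of x] has_derivative_unique unfolding op_norm_def jacobian_works by blast
  then have bound: "sup_op_norm (\<lambda>x. jacobian (Y 1) (at x)) \<le> ereal (exp (k / 2))"
    by (simp add: sup_op_norm_le_iff)
  \<comment> \<open>The exponential bound supplies the finiteness that the mean value argument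
    requires.\<close>
  then have "Lip (Y 1) \<le> sup_op_norm (\<lambda>x. jacobian (Y 1) (at x))"
    using diff by (intro Lip_le_sup_op_norm_jacobian) auto
  with diff bound show ?thesis
    by (simp add: k_def)
qed

end
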